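(* For every integer $r\ge 1$, the probability that a medial regime random simplicial complex $Y\subset\Delta_n$ is $r$-ample tends to $1$ as $n\to\infty$.
   Context: For a simplicial complex $X$, $V(X)$ is its vertex set; for $U\subseteq V(X)$, $X_U$ is the induced subcomplex on $U$ (vertex set $U$, whose simplices are exactly the simplices of $X$ with all vertices in $U$). For a vertex $v$, the link ${\rm lk}_X(v)$ is the subcomplex of all simplices $\sigma$ of $X$ with $v\notin\sigma$ such that $\sigma\cup\{v\}$ is a simplex of $X$. Simplices are nonempty; subcomplexes are allowed to be empty. For an integer $r\ge 1$, a nonempty simplicial complex $X$ is $r$-ample if for each $U\subseteq V(X)$ with $|U|\le r$ and each subcomplex $A\subseteq X_U$ (possibly empty) there is a vertex $v\in V(X)\setminus U$ with ${\rm lk}_X(v)\cap X_U=A$. Random model: $\Delta_n$ is the full simplex on the vertex set $[n]=\{1,\dots,n\}$. For every simplex $\sigma\subset\Delta_n$ (nonempty subset of $[n]$, including single vertices) a probability parameter $p_\sigma\in[0,1]$ is given, and $q_\sigma=1-p_\sigma$. For a subcomplex $Y\subset\Delta_n$ (possibly empty, not necessarily containing all of $[n]$ as vertices), $F(Y)$ is the set of simplices of $Y$ and $E(Y)$ is the set of external faces, i.e. simplices $\sigma\subset\Delta_n$ with $\sigma\not\subset Y$ and $\partial\sigma\subset Y$ (in particular vertices of $[n]$ not in $Y$ are external faces). The probability measure on the set of subcomplexes of $\Delta_n$ is $$P(Y)=\prod_{\sigma\in F(Y)}p_\sigma\cdot\prod_{\sigma\in E(Y)}q_\sigma .$$ The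 random complex is in the medial regime if $p_\sigma\in[p,1-p]$ for all $\sigma$, where $p\in(0,1)$ is a constant not depending on $n$ (the parameters $p_\sigma$ themselves may depend on $\sigma$ and $n$). *)

theory Defs
  imports "HOL-Probability.Probability"
begin

text \<open>
  Abstract simplicial complexes are represented by their sets of (nonempty, finite) simplices, so
  the empty set is the empty complex. HOL-Analysis already has a \<open>simplicial_complex\<close>, but
  that is the geometric notion (a set of convex simplices in a Euclidean space).
\<close>

definition abstract_complex :: "'a set set \<Rightarrow> bool" where
  "abstract_complex X \<longleftrightarrow>
     (\<forall>\<sigma>\<in>X. finite \<sigma> \<and> \<sigma> \<noteq> {}) \<and>
     (\<forall>\<sigma>\<in>X. \<forall>\<tau>. \<tau> \<noteq> {} \<and> \<tau> \<subseteq> \<sigma> \<longrightarrow> \<tau> \<in> X)"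

definition subcomplex :: "'a set set \<Rightarrow> 'a set set \<Rightarrow> bool" where
  "subcomplex A X \<longleftrightarrow> abstract_complex A \<and> A \<subseteq> X"

definition vertex_set :: "'a set set \<Rightarrow> 'a set" where
  "vertex_set X = {v. {v} \<in> X}"

definition induced_subcomplex :: "'a set set \<Rightarrow> 'a set \<Rightarrow> 'a set set" where
  "induced_subcomplex X U = {\<sigma> \<in> X. \<sigma> \<subseteq> U}"

definition vertex_link :: "'a set set \<Rightarrow> 'a \<Rightarrow> 'a set set" where
  "vertex_link X v = {\<sigma> \<in> X. v \<notin> \<sigma> \<and> insert v \<sigma> \<in> X}"

definition ample :: "nat \<Rightarrow> 'a set set \<Rightarrow> bool" where
  "ample r X \<longleftrightarrow> abstract_complex X \<and> X \<noteq> {} \<and>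
     (\<forall>U A. U \<subseteq> vertex_set X \<and> finite U \<and> card U \<le> r \<and> subcomplex A (induced_subcomplex X U) \<longrightarrow>
        (\<exists>v \<in> vertex_set X - U. vertex_link X v \<inter> induced_subcomplex X U = A))"

definition full_simplex :: "nat \<Rightarrow> nat set set" where
  "full_simplex n = {\<sigma>. \<sigma> \<noteq> {} \<and> \<sigma> \<subseteq> {1..n}}"

definition simplex_boundary :: "'a set \<Rightarrow> 'a set set" where
  "simplex_boundary \<sigma> = {\<tau>. \<tau> \<noteq> {} \<and> \<tau> \<subset> \<sigma>}"

text \<open>A vertex has empty boundary, so every \<open>{v}\<close> with \<open>v \<in> {1..n}\<close> not in \<open>Y\<close> is an external face.\<close>

definition external_faces :: "nat \<Rightarrow> nat set set \<Rightarrow> nat set set" where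
  "external_faces n Y = {\<sigma> \<in> full_simplex n. \<sigma> \<notin> Y \<and> simplex_boundary \<sigma> \<subseteq> Y}"

definition complex_weight :: "nat \<Rightarrow> (nat set \<Rightarrow> real) \<Rightarrow> nat set set \<Rightarrow> real" where
  "complex_weight n p Y = (\<Prod>\<sigma>\<in>Y. p \<sigma>) * (\<Prod>\<sigma>\<in>external_faces n Y. 1 - p \<sigma>)"

definition random_complex :: "nat \<Rightarrow> (nat set \<Rightarrow> real) \<Rightarrow> nat set set measure" where
  "random_complex n p =
     point_measure {Y. subcomplex Y (full_simplex n)} (\<lambda>Y. ennreal (complex_weight n p Y))"

text \<open>
  The parameters \<open>ps n \<sigma>\<close> may depend on \<open>n\<close> and \<open>\<sigma>\<close>; the constant \<open>p\<close> may not.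
\<close>

definition medial_regime :: "(nat \<Rightarrow> nat set \<Rightarrow> real) \<Rightarrow> bool" where
  "medial_regime ps \<longleftrightarrow>
     (\<exists>p. 0 < p \<and> p < 1 \<and> (\<forall>n. \<forall>\<sigma>\<in>full_simplex n. ps n \<sigma> \<in> {p..1 - p}))"

end

theory Submission
  imports Defs "HOL-Real_Asymp.Real_Asymp"
begin

text \<open>
  Select every simplex \<open>\<sigma>\<close> independently with probability \<open>p\<^sub>\<sigma>\<close>. The largest
  complex all of whose simplices are selected has the law of the model, because it equals \<open>Y\<close>
  iff all of \<open>Y\<close> and none of \<open>E(Y)\<close> is selected. For given \<open>U\<close> and \<open>A\<close>, a
  vertex \<open>v\<close> outside \<open>U\<close> realises \<open>A\<close> as soon as, for \<open>\<tau> \<subseteq> U\<close>, the simplex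
  \<open>{v} \<union> \<tau>\<close> is selected exactly if \<open>\<tau> \<in> A\<close> or \<open>\<tau> = {}\<close>. For distinct
  \<open>v\<close> these events depend on disjoint sets of simplices and each has probability at least
  \<open>p\<^bsup>2^r\<^esup>\<close>, so all vertices fail with probability at most
  \<open>(1 - p\<^bsup>2^r\<^esup>)\<^bsup>n-r\<^esup>\<close>, which beats the \<open>O(n\<^sup>r)\<close> choices of
  \<open>U\<close> and \<open>A\<close>.
\<close>

section \<open>Independence over disjoint blocks of coordinates\<close>

lemma prob_Pi_pmf_all_blocks_fail:
  assumes I: "finite I" and V: "finite V"
    and K: "\<And>v. v \<in> V \<Longrightarrow> K v \<subseteq> I" and disj: "disjoint_family_on K V"
  shows "measure_pmf.prob (Pi_pmf I d f) {h. \<forall>v\<in>V. \<exists>x\<in>K v. h x \<notin> B x}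
           = (\<Prod>v\<in>V. 1 - (\<Prod>x\<in>K v. measure_pmf.prob (f x) (B x)))"
\<comment> \<open>The product rule for independent variables asks for a nonempty index set; for
  empty \<open>V\<close> both sides are 1.\<close>
proof (cases "V = {}")
  case False
  let ?M = "measure_pmf (Pi_pmf I d f)"
  \<comment> \<open>Restrictions of \<open>h\<close> to disjoint blocks are independent, and block
    \<open>v\<close> fails exactly when its restriction leaves the box
    \<open>Pi\<^sub>E (K v) B\<close>.\<close>
  let ?X = "\<lambda>v h. restrict (\<lambda>x. h x) (K v)"
  let ?S = "\<lambda>v. space (Pi\<^sub>M (K v) (\<lambda>_. count_space UNIV)) - Pi\<^sub>E (K v) B"
  have fin: "finite (K v)" if "v \<in> V" for v
    using K[OF that] I by (rule finite_subset)
  have ind: "prob_space.indep_vars ?M (\<lambda>v. Pi\<^sub>M (K v) (\<lambda>_. count_space UNIV)) ?X V"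
    using prob_space.indep_vars_restrict[OF measure_pmf.prob_space_axioms
        indep_vars_Pi_pmf[OF I] K disj] by simp
  have X: "?X v -` ?S v = - Pi (K v) B" for v
    by (auto simp: space_PiM PiE_def Pi_def)
  have eq: "{h. \<forall>v\<in>V. \<exists>x\<in>K v. h x \<notin> B x} = (\<Inter>v\<in>V. ?X v -` ?S v \<inter> space ?M)"
    unfolding X by (auto simp: Pi_def)
  have "measure ?M {h. \<forall>v\<in>V. \<exists>x\<in>K v. h x \<notin> B x}
          = (\<Prod>v\<in>V. measure ?M (?X v -` ?S v \<inter> space ?M))"
    unfolding eq
    by (rule prob_space.indep_varsD_finite[OF measure_pmf.prob_space_axioms ind False V])
       (intro sets.Diff sets.top sets_PiM_I_finite, auto intro: fin)
  also have "\<dots> = (\<Prod>v\<in>V. 1 - (\<Prod>x\<in>K v. measure_pmf.prob (f x) (B x)))"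
  proof (rule prod.cong[OF refl])
    fix v assume v: "v \<in> V"
    \<comment> \<open>Padding with \<open>UNIV\<close> outside the block turns the event into a box
      over all of \<open>I\<close>; the added factors are 1.\<close>
    let ?B = "\<lambda>x. if x \<in> K v then B x else UNIV"
    have Pi: "Pi (K v) B = Pi I ?B"
      using K[OF v] by (auto simp: Pi_def)
    have "measure ?M (Pi (K v) B) = (\<Prod>x\<in>I. measure_pmf.prob (f x) (?B x))"
      unfolding Pi by (rule measure_Pi_pmf_Pi[OF I])
    also have "\<dots> = (\<Prod>x\<in>K v. measure_pmf.prob (f x) (B x))"
      using I K[OF v] by (intro prod.mono_neutral_cong_right) auto
    finally show "measure ?M (?X v -` ?S v \<inter> space ?M)
        = 1 - (\<Prod>x\<in>K v. measure_pmf.prob (f x) (B x))"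
      unfolding X using measure_pmf.prob_compl[of "Pi (K v) B" "Pi_pmf I d f"]
      by (simp add: Compl_eq_Diff_UNIV)
  qed
  finally show ?thesis .
qed simp

section \<open>The model as a function of independent selections\<close>

lemma subcomplex_downward_closed:
  assumes "subcomplex A X" "\<sigma> \<in> A" "\<tau> \<noteq> {}" "\<tau> \<subseteq> \<sigma>"
  shows "\<tau> \<in> A"
proof -
  have "\<forall>\<sigma>\<in>A. \<forall>\<tau>. \<tau> \<noteq> {} \<and> \<tau> \<subseteq> \<sigma> \<longrightarrow> \<tau> \<in> A"
    using assms(1) unfolding subcomplex_def abstract_complex_def by (elim conjE)
  from this[rule_format, OF assms(2) conjI[OF assms(3,4)]] show ?thesis .
qed

lemma finite_full_simplex [simp]: "finite (full_simplex n)"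
  by (rule finite_subset[of _ "Pow {1..n}"]) (auto simp: full_simplex_def)

lemma finite_subcomplexes: "finite {Y. subcomplex Y (full_simplex n)}"
  by (rule finite_subset[of _ "Pow (full_simplex n)"]) (auto simp: subcomplex_def)

definition kernel_complex :: "nat \<Rightarrow> (nat set \<Rightarrow> bool) \<Rightarrow> nat set set" where
  "kernel_complex n h = {\<sigma> \<in> full_simplex n. \<forall>\<tau>. \<tau> \<noteq> {} \<and> \<tau> \<subseteq> \<sigma> \<longrightarrow> h \<tau>}"

lemma subcomplex_kernel_complex: "subcomplex (kernel_complex n h) (full_simplex n)"
  by (auto simp: subcomplex_def abstract_complex_def kernel_complex_def full_simplex_def
      intro: finite_subset)

text \<open>A selected external face of the kernel would have all its proper faces in the kernel and
  hence belong to it. Conversely, a minimal kernel simplex outside \<open>Y\<close> would have its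
  boundary in \<open>Y\<close>, so it would be an external face that is selected.\<close>

lemma kernel_complex_eq_iff:
  assumes "subcomplex Y (full_simplex n)"
  shows "kernel_complex n h = Y \<longleftrightarrow> (\<forall>\<sigma>\<in>Y. h \<sigma>) \<and> (\<forall>\<sigma>\<in>external_faces n Y. \<not> h \<sigma>)"
proof (intro iffI conjI ballI notI)
  fix \<sigma> assume Y: "kernel_complex n h = Y"
  show "h \<sigma>" if "\<sigma> \<in> Y"
    using that unfolding Y[symmetric] kernel_complex_def full_simplex_def by blast
  assume \<sigma>: "\<sigma> \<in> external_faces n Y" and h: "h \<sigma>"
  have "h \<tau>" if "\<tau> \<noteq> {}" "\<tau> \<subset> \<sigma>" for \<tau>
    using \<sigma> that unfolding Y[symmetric] external_faces_def simplex_boundary_def kernel_complex_def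
    by blast
  then have "\<sigma> \<in> kernel_complex n h"
    using \<sigma> h unfolding external_faces_def kernel_complex_def by blast
  then show False using \<sigma> Y by (simp add: external_faces_def)
next
  assume "(\<forall>\<sigma>\<in>Y. h \<sigma>) \<and> (\<forall>\<sigma>\<in>external_faces n Y. \<not> h \<sigma>)"
  then have Y: "\<forall>\<sigma>\<in>Y. h \<sigma>" and E: "\<forall>\<sigma>\<in>external_faces n Y. \<not> h \<sigma>" by blast+
  have "\<sigma> \<in> kernel_complex n h" if "\<sigma> \<in> Y" for \<sigma>
  proof -
    have "\<sigma> \<in> full_simplex n" and "\<And>\<tau>. \<tau> \<noteq> {} \<Longrightarrow> \<tau> \<subseteq> \<sigma> \<Longrightarrow> \<tau> \<in> Y"
      using that assms subcomplex_downward_closed[OF assms that] by (auto simp: subcomplex_def)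
    then show ?thesis using Y by (simp add: kernel_complex_def)
  qed
  moreover have "\<sigma> \<in> Y" if "\<sigma> \<in> kernel_complex n h" for \<sigma>
  proof -
    have "finite \<sigma>"
      using that by (auto simp: kernel_complex_def full_simplex_def intro: finite_subset)
    then show ?thesis using that
    proof (induction \<sigma> rule: finite_psubset_induct)
      case (psubset \<sigma>)
      have "\<tau> \<in> Y" if "\<tau> \<noteq> {}" "\<tau> \<subset> \<sigma>" for \<tau>
        using psubset.IH[OF that(2)] psubset.prems that
        unfolding kernel_complex_def full_simplex_def by blast
      then have "\<sigma> \<in> Y \<or> \<sigma> \<in> external_faces n Y"
        using psubset.prems
        unfolding external_faces_def simplex_boundary_def kernel_complex_def by blast
      moreover have "h \<sigma>" using psubset.prems unfolding kernel_complex_def full_simplex_def by blast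
      ultimately show ?case using E by blast
    qed
  qed
  ultimately show "kernel_complex n h = Y" by blast
qed

text \<open>The default \<open>False\<close> outside \<open>full_simplex n\<close> is harmless:
  \<open>kernel_complex n\<close> only inspects nonempty faces of simplices in
  \<open>full_simplex n\<close>.\<close>

definition random_selection :: "nat \<Rightarrow> (nat set \<Rightarrow> real) \<Rightarrow> (nat set \<Rightarrow> bool) pmf" where
  "random_selection n p = Pi_pmf (full_simplex n) False (\<lambda>\<sigma>. bernoulli_pmf (p \<sigma>))"

lemma complex_weight_eq_prob:
  assumes p: "\<And>\<sigma>. \<sigma> \<in> full_simplex n \<Longrightarrow> p \<sigma> \<in> {0..1}"
    and Y: "subcomplex Y (full_simplex n)"
  shows "complex_weight n p Y
           = measure_pmf.prob (random_selection n p) {h. kernel_complex n h = Y}"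
proof -
  let ?F = "full_simplex n" and ?E = "external_faces n Y"
  \<comment> \<open>By \<open>kernel_complex_eq_iff\<close> the event is a box: coordinates in
    \<open>Y\<close> are forced to be true, external faces to be false, and all others are free and
    contribute factors 1.\<close>
  let ?B = "\<lambda>\<sigma>. if \<sigma> \<in> Y then {True} else if \<sigma> \<in> ?E then {False} else UNIV"
  have sub: "Y \<subseteq> ?F" "?E \<subseteq> ?F" and disj: "Y \<inter> ?E = {}"
    using Y by (auto simp: subcomplex_def external_faces_def)
  have fin: "finite Y" "finite ?E"
    using sub finite_subset[OF _ finite_full_simplex] by blast+
  have Pi: "{h. kernel_complex n h = Y} = Pi ?F ?B"
    using sub disj by (auto simp: kernel_complex_eq_iff[OF Y] Pi_def split: if_splits)
  have "measure_pmf.prob (random_selection n p) {h. kernel_complex n h = Y}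
      = (\<Prod>\<sigma>\<in>?F. measure_pmf.prob (bernoulli_pmf (p \<sigma>)) (?B \<sigma>))"
    unfolding random_selection_def Pi by (rule measure_Pi_pmf_Pi[OF finite_full_simplex])
  also have "\<dots> = (\<Prod>\<sigma>\<in>Y \<union> ?E. measure_pmf.prob (bernoulli_pmf (p \<sigma>)) (?B \<sigma>))"
    using sub by (intro prod.mono_neutral_right) auto
  also have "\<dots> = (\<Prod>\<sigma>\<in>Y. measure_pmf.prob (bernoulli_pmf (p \<sigma>)) (?B \<sigma>))
      * (\<Prod>\<sigma>\<in>?E. measure_pmf.prob (bernoulli_pmf (p \<sigma>)) (?B \<sigma>))"
    by (rule prod.union_disjoint[OF fin disj])
  also have "(\<Prod>\<sigma>\<in>Y. measure_pmf.prob (bernoulli_pmf (p \<sigma>)) (?B \<sigma>)) = (\<Prod>\<sigma>\<in>Y. p \<sigma>)"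
    using p sub by (intro prod.cong) (auto simp: measure_pmf_single subset_iff)
  also have "(\<Prod>\<sigma>\<in>?E. measure_pmf.prob (bernoulli_pmf (p \<sigma>)) (?B \<sigma>)) = (\<Prod>\<sigma>\<in>?E. 1 - p \<sigma>)"
    using p sub disj by (intro prod.cong) (auto simp: measure_pmf_single subset_iff)
  finally show ?thesis by (simp add: complex_weight_def)
qed

text \<open>The events \<open>kernel_complex n h = Y\<close> for different \<open>Y\<close> are
  disjoint and their probabilities are the weights. Taking \<open>P\<close> to be always true shows
  that the weights sum to 1.\<close>

lemma measure_random_complex:
  assumes p: "\<And>\<sigma>. \<sigma> \<in> full_simplex n \<Longrightarrow> p \<sigma> \<in> {0..1}"
  shows "measure (random_complex n p) {Y \<in> space (random_complex n p). P Y}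
           = measure_pmf.prob (random_selection n p) {h. P (kernel_complex n h)}"
proof -
  let ?S = "{Y. subcomplex Y (full_simplex n)}"
  let ?Q = "{Y \<in> ?S. P Y}"
  let ?M = "measure_pmf (random_selection n p)"
  have fin: "finite ?Q" by (rule finite_subset[OF _ finite_subcomplexes]) auto
  have w: "complex_weight n p Y = measure ?M {h. kernel_complex n h = Y}" if "Y \<in> ?S" for Y
    using complex_weight_eq_prob[of n p Y] p that by simp
  \<comment> \<open>Leaving \<open>ennreal\<close> requires nonnegative weights; by \<open>w\<close>
    they are probabilities.\<close>
  have "measure (random_complex n p) ?Q = (\<Sum>Y\<in>?Q. complex_weight n p Y)"
    unfolding random_complex_def Sigma_Algebra.measure_def
    using finite_subcomplexes w
    by (subst emeasure_point_measure_finite) (auto simp: sum_nonneg)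
  also have "\<dots> = (\<Sum>Y\<in>?Q. measure ?M {h. kernel_complex n h = Y})"
    using w by (intro sum.cong) auto
  also have "\<dots> = measure ?M (\<Union>Y\<in>?Q. {h. kernel_complex n h = Y})"
    using fin by (intro measure_pmf.finite_measure_finite_Union[symmetric])
      (auto simp: disjoint_family_on_def)
  also have "(\<Union>Y\<in>?Q. {h. kernel_complex n h = Y}) = {h. P (kernel_complex n h)}"
    using subcomplex_kernel_complex by auto
  finally show ?thesis by (simp add: random_complex_def space_point_measure)
qed

section \<open>Ampleness from vertices that realise prescribed links\<close>

definition realises :: "(nat set \<Rightarrow> bool) \<Rightarrow> nat set \<Rightarrow> nat set set \<Rightarrow> nat \<Rightarrow> bool" where
  "realises h U A v \<longleftrightarrow> (\<forall>\<tau>\<subseteq>U. h (insert v \<tau>) \<longleftrightarrow> \<tau> \<in> insert {} A)"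

text \<open>For \<sigma> in \<open>insert {} A\<close>, a face of \<open>insert v \<sigma>\<close>
  without \<open>v\<close> already has its selection from the complex. A face with \<open>v\<close>
  leaves, after removal of \<open>v\<close>, a member of \<open>insert {} A\<close> because
  \<open>A\<close> is closed downwards, so \<open>realises\<close> selects it. The case of empty
  \<sigma> makes \<open>v\<close> a vertex.\<close>

lemma vertex_link_of_realises:
  assumes v: "v \<in> {1..n} - U" and real: "realises h U A v"
    and A: "subcomplex A (induced_subcomplex (kernel_complex n h) U)"
  shows "v \<in> vertex_set (kernel_complex n h) - U"
    and "vertex_link (kernel_complex n h) v \<inter> induced_subcomplex (kernel_complex n h) U = A"
proof -
  let ?Y = "kernel_complex n h"
  have in_Y: "insert v \<sigma> \<in> ?Y" if \<sigma>: "\<sigma> \<in> insert {} A" for \<sigma>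
  proof -
    have "\<sigma> = {} \<or> \<sigma> \<in> ?Y" and sub: "\<sigma> \<subseteq> U"
      using \<sigma> A by (auto simp: subcomplex_def induced_subcomplex_def)
    then have full: "insert v \<sigma> \<in> full_simplex n" and h: "\<And>\<tau>. \<tau> \<noteq> {} \<Longrightarrow> \<tau> \<subseteq> \<sigma> \<Longrightarrow> h \<tau>"
      using v by (auto simp: kernel_complex_def full_simplex_def)
    have "h \<tau>" if \<tau>: "\<tau> \<noteq> {}" "\<tau> \<subseteq> insert v \<sigma>" for \<tau>
    proof (cases "v \<in> \<tau>")
      case True
      have \<tau>v: "\<tau> - {v} \<subseteq> \<sigma>" using \<tau> by blast
      have "\<tau> - {v} \<in> insert {} A"
      proof (cases "\<tau> - {v} = {}")
        case False
        then have "\<sigma> \<in> A" using \<sigma> \<tau>v by auto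
        from subcomplex_downward_closed[OF A this False \<tau>v] show ?thesis by simp
      qed simp
      moreover have "\<tau> - {v} \<subseteq> U" using \<tau>v sub by (rule subset_trans)
      ultimately have "h (insert v (\<tau> - {v}))" using real unfolding realises_def by blast
      then show ?thesis using True by (simp add: insert_absorb)
    next
      case False
      then show ?thesis using h \<tau> by blast
    qed
    then show ?thesis using full by (simp add: kernel_complex_def)
  qed
  show "v \<in> vertex_set ?Y - U" using in_Y[of "{}"] v by (simp add: vertex_set_def)
  show "vertex_link ?Y v \<inter> induced_subcomplex ?Y U = A"
  proof safe
    fix \<sigma> assume "\<sigma> \<in> vertex_link ?Y v" "\<sigma> \<in> induced_subcomplex ?Y U"
    then have "h (insert v \<sigma>)" "\<sigma> \<subseteq> U" "\<sigma> \<noteq> {}"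
      by (auto simp: vertex_link_def induced_subcomplex_def kernel_complex_def full_simplex_def)
    then show "\<sigma> \<in> A" using real by (auto simp: realises_def)
  next
    fix \<sigma> assume \<sigma>: "\<sigma> \<in> A"
    then show ind: "\<sigma> \<in> induced_subcomplex ?Y U" using A by (auto simp: subcomplex_def)
    then show "\<sigma> \<in> vertex_link ?Y v"
      using in_Y[of \<sigma>] \<sigma> v by (auto simp: vertex_link_def induced_subcomplex_def)
  qed
qed

text \<open>The hypothesis ranges over all \<open>U\<close> in \<open>{1..n}\<close> and all
  families \<open>A\<close> of subsets of \<open>U\<close>, so the index set of the later union
  bound does not depend on the random \<open>h\<close>.\<close>

lemma ample_kernel_complex:
  assumes "\<And>U A. U \<subseteq> {1..n} \<Longrightarrow> card U \<le> r \<Longrightarrow> A \<subseteq> Pow U \<Longrightarrow> \<exists>v\<in>{1..n} - U. realises h U A v"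
  shows "ample r (kernel_complex n h)"
proof -
  let ?Y = "kernel_complex n h"
  have ext: "\<exists>v\<in>vertex_set ?Y - U. vertex_link ?Y v \<inter> induced_subcomplex ?Y U = A"
    if U: "U \<subseteq> vertex_set ?Y" "card U \<le> r" and A: "subcomplex A (induced_subcomplex ?Y U)" for U A
  proof -
    have "U \<subseteq> {1..n}" "A \<subseteq> Pow U"
      using U A by (auto simp: vertex_set_def kernel_complex_def full_simplex_def
          subcomplex_def induced_subcomplex_def)
    with assms U obtain v where "v \<in> {1..n} - U" "realises h U A v" by blast
    from vertex_link_of_realises[OF this A] show ?thesis by blast
  qed
  have "subcomplex {} (induced_subcomplex ?Y {})"
    by (simp add: subcomplex_def abstract_complex_def)
  \<comment> \<open>The extension property for empty \<open>U\<close> and \<open>A\<close> already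
    produces a vertex.\<close>
  then have "?Y \<noteq> {}" using ext[of "{}" "{}"] by (auto simp: vertex_set_def)
  then show ?thesis
    using ext subcomplex_kernel_complex[of n h] by (auto simp: ample_def subcomplex_def)
qed

section \<open>Failure probabilities and the union bound\<close>

lemma prob_no_vertex_realises:
  assumes p0: "0 < p"
    and q: "\<And>\<sigma>. \<sigma> \<in> full_simplex n \<Longrightarrow> q \<sigma> \<in> {p..1 - p}"
    and U: "U \<subseteq> {1..n}" "card U \<le> r"
  shows "measure_pmf.prob (random_selection n q) {h. \<forall>v\<in>{1..n} - U. \<not> realises h U A v}
           \<le> (1 - p ^ 2 ^ r) ^ (n - r)"
\<comment> \<open>For \<open>n \<le> r\<close> the truncated exponent is 0 and the bound is
  1.\<close>
proof (cases "n \<le> r")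
  case False
  let ?V = "{1..n} - U"
  \<comment> \<open>For \<open>v\<close> outside \<open>U\<close>, each member of block
    \<open>v\<close> has \<open>v\<close> as its only element outside \<open>U\<close>, so the
    blocks are disjoint; and intersecting with \<open>U\<close> recovers \<tau> from
    \<open>insert v \<tau>\<close>, so the required value can be written in terms of \<sigma>
    alone.\<close>
  let ?K = "\<lambda>v. insert v ` Pow U"
  let ?B = "\<lambda>\<sigma>. {\<sigma> \<inter> U \<in> insert {} A}"
  let ?pr = "\<lambda>\<sigma>. measure_pmf.prob (bernoulli_pmf (q \<sigma>)) (?B \<sigma>)"
  have finU: "finite U" using U finite_subset by blast
  have K: "?K v \<subseteq> full_simplex n" if "v \<in> ?V" for v
    using that U by (auto simp: full_simplex_def)
  have disj: "disjoint_family_on ?K ?V"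
    by (auto simp: disjoint_family_on_def)
  \<comment> \<open>Here \<open>n > r\<close>, so the simplex \<open>{1}\<close> exists and its
    parameter interval is nonempty.\<close>
  have p1: "p \<le> 1"
    using q[of "{1}"] False by (auto simp: full_simplex_def)
  have fails: "(\<not> realises h U A v) = (\<exists>\<sigma>\<in>?K v. h \<sigma> \<notin> ?B \<sigma>)" if "v \<in> ?V" for h v
  proof -
    have "insert v \<tau> \<inter> U = \<tau>" if "\<tau> \<subseteq> U" for \<tau> using that \<open>v \<in> ?V\<close> by blast
    then show ?thesis by (auto simp: realises_def)
  qed
  have eq: "{h. \<forall>v\<in>?V. \<not> realises h U A v} = {h. \<forall>v\<in>?V. \<exists>\<sigma>\<in>?K v. h \<sigma> \<notin> ?B \<sigma>}"
    by (intro Collect_cong ball_cong refl fails)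
  have "measure_pmf.prob (random_selection n q) {h. \<forall>v\<in>?V. \<not> realises h U A v}
      = (\<Prod>v\<in>?V. 1 - (\<Prod>\<sigma>\<in>?K v. ?pr \<sigma>))"
    unfolding random_selection_def eq
    by (rule prob_Pi_pmf_all_blocks_fail[OF finite_full_simplex _ K disj]) simp_all
  also have "\<dots> \<le> (\<Prod>v\<in>?V. 1 - p ^ 2 ^ r)"
  proof (intro prod_mono conjI)
    fix v assume v: "v \<in> ?V"
    \<comment> \<open>The medial regime enters here: whichever truth value is required, its
      probability, \<open>q \<sigma>\<close> or \<open>1 - q \<sigma>\<close>, is at least
      \<open>p\<close>.\<close>
    have pr: "p \<le> ?pr \<sigma>" if "\<sigma> \<in> ?K v" for \<sigma>
    proof -
      have "q \<sigma> \<in> {p..1 - p}" using q K[OF v] that by blast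
      then show ?thesis using p0
        by (cases "\<sigma> \<inter> U \<in> insert {} A") (auto simp: measure_pmf_single)
    qed
    have "card (?K v) \<le> card (Pow U)" using finU by (intro card_image_le) simp
    also have "\<dots> \<le> 2 ^ r" using U by (simp add: card_Pow[OF finU])
    finally have "p ^ 2 ^ r \<le> p ^ card (?K v)" using p0 p1 by (intro power_decreasing) auto
    also have "\<dots> = (\<Prod>\<sigma>\<in>?K v. p)" by simp
    also have "\<dots> \<le> (\<Prod>\<sigma>\<in>?K v. ?pr \<sigma>)" using pr p0 by (intro prod_mono) auto
    finally show "1 - (\<Prod>\<sigma>\<in>?K v. ?pr \<sigma>) \<le> 1 - p ^ 2 ^ r" by simp
    show "0 \<le> 1 - (\<Prod>\<sigma>\<in>?K v. ?pr \<sigma>)" by (simp add: prod_le_1)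
  qed
  also have "\<dots> = (1 - p ^ 2 ^ r) ^ (n - card U)"
    using U finU by (simp add: card_Diff_subset)
  also have "\<dots> \<le> (1 - p ^ 2 ^ r) ^ (n - r)"
    using U p0 p1 by (intro power_decreasing) (auto simp: power_le_one)
  finally show ?thesis .
qed simp

text \<open>List the elements of \<open>U\<close> and pad with 0, which is not in
  \<open>{1..n}\<close>, to a word of length \<open>r\<close> over \<open>{0..n}\<close>; deleting 0
  recovers \<open>U\<close>.\<close>

lemma finite_card_small_subsets:
  "finite {U. U \<subseteq> {1..n} \<and> card U \<le> r}" (is "finite ?S")
  "card {U. U \<subseteq> {1..n} \<and> card U \<le> r} \<le> (n + 1) ^ r"
proof -
  show "finite ?S" by (rule finite_subset[of _ "Pow {1..n}"]) auto
  let ?L = "{xs. set xs \<subseteq> {0..n} \<and> length xs = r}"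
  have "U \<in> (\<lambda>xs. set xs - {0}) ` ?L" if U: "U \<in> ?S" for U
  proof -
    have "finite U" using U finite_subset by blast
    then obtain xs where xs: "set xs = U" "distinct xs" using finite_distinct_list by blast
    let ?ys = "xs @ replicate (r - card U) 0"
    have "length xs = card U" using xs distinct_card by metis
    then have "?ys \<in> ?L" using xs U by auto
    moreover have "set ?ys - {0} = U" using xs U by auto
    ultimately show ?thesis by blast
  qed
  then have "card ?S \<le> card ((\<lambda>xs. set xs - {0}) ` ?L)"
    by (intro card_mono finite_imageI finite_lists_length_eq) auto
  also have "\<dots> \<le> card ?L" by (intro card_image_le finite_lists_length_eq) auto
  also have "\<dots> = (n + 1) ^ r" by (simp add: card_lists_length_eq)
  finally show "card ?S \<le> (n + 1) ^ r" .
qed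

text \<open>Union bound over the pairs of \<open>U\<close> and \<open>A\<close>: each
  \<open>U\<close> of size at most \<open>r\<close> admits at most \<open>2 ^ 2 ^ r\<close> families
  \<open>A\<close>.\<close>

lemma prob_not_ample_le:
  assumes p0: "0 < p" "p < 1"
    and q: "\<And>\<sigma>. \<sigma> \<in> full_simplex n \<Longrightarrow> q \<sigma> \<in> {p..1 - p}"
  shows "measure_pmf.prob (random_selection n q) {h. \<not> ample r (kernel_complex n h)}
           \<le> (real n + 1) ^ r * 2 ^ 2 ^ r * (1 - p ^ 2 ^ r) ^ (n - r)"
proof -
  let ?M = "measure_pmf (random_selection n q)"
  let ?c = "(1 - p ^ 2 ^ r) ^ (n - r)"
  let ?S = "{U. U \<subseteq> {1..n} \<and> card U \<le> r}"
  let ?I = "Sigma ?S (\<lambda>U. Pow (Pow U))"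
  let ?bad = "\<lambda>(U, A). {h. \<forall>v\<in>{1..n} - U. \<not> realises h U A v}"
  have finU: "finite U" if "U \<in> ?S" for U
    using that by (auto intro: finite_subset)
  then have finP: "\<forall>U\<in>?S. finite (Pow (Pow U))"
    by (simp only: finite_Pow_iff) blast
  then have finI: "finite ?I"
    by (intro finite_SigmaI finite_card_small_subsets) blast
  have "card ?I = (\<Sum>U\<in>?S. card (Pow (Pow U)))"
    by (rule card_SigmaI[OF finite_card_small_subsets(1) finP])
  also have "\<dots> = (\<Sum>U\<in>?S. 2 ^ 2 ^ card U)"
    by (intro sum.cong refl) (simp only: card_Pow finite_Pow_iff finU)
  also have "\<dots> \<le> card ?S * 2 ^ 2 ^ r"
    using sum_bounded_above[of ?S "\<lambda>U. 2 ^ 2 ^ card U" "2 ^ 2 ^ r :: nat"] by auto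
  also have "\<dots> \<le> (n + 1) ^ r * 2 ^ 2 ^ r"
    using finite_card_small_subsets(2) by (rule mult_right_mono) simp
  finally have "real (card ?I) \<le> real ((n + 1) ^ r * 2 ^ 2 ^ r)"
    by (simp only: of_nat_le_iff)
  then have cardI: "real (card ?I) \<le> (real n + 1) ^ r * 2 ^ 2 ^ r"
    by (simp add: add.commute)
  have "{h. \<not> ample r (kernel_complex n h)} \<subseteq> (\<Union>i\<in>?I. ?bad i)"
    using ample_kernel_complex[of n r] by fastforce
  then have "measure ?M {h. \<not> ample r (kernel_complex n h)} \<le> measure ?M (\<Union>i\<in>?I. ?bad i)"
    by (intro measure_pmf.finite_measure_mono) auto
  also have "\<dots> \<le> (\<Sum>i\<in>?I. measure ?M (?bad i))"
    using finI by (intro measure_UNION_le) auto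
  also have "\<dots> \<le> real (card ?I) * ?c"
    using prob_no_vertex_realises[OF p0(1) q] by (intro sum_bounded_above) auto
  also have "\<dots> \<le> (real n + 1) ^ r * 2 ^ 2 ^ r * ?c"
    using cardI p0 by (intro mult_right_mono) (auto simp: power_le_one)
  finally show ?thesis .
qed

section \<open>Passage to the limit\<close>

lemma polynomial_times_geometric_tendsto_0:
  fixes c d :: real
  assumes "0 < c" "c < 1"
  shows "(\<lambda>n. (real n + 1) ^ r * d * c ^ (n - r)) \<longlonglongrightarrow> 0"
proof -
  \<comment> \<open>Shifting the index by \<open>r\<close> removes the truncated subtraction;
    \<open>LIMSEQ_offset\<close> undoes the shift.\<close>
  have "(\<lambda>n. (real (n + r) + 1) ^ r * c ^ n) \<longlonglongrightarrow> 0"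
    using assms by real_asymp
  from tendsto_mult_left[OF this, of d]
  have "(\<lambda>n. (real (n + r) + 1) ^ r * d * c ^ (n + r - r)) \<longlonglongrightarrow> 0"
    by (simp add: algebra_simps)
  then show ?thesis by (rule LIMSEQ_offset)
qed

theorem proposition5p1:
  fixes r :: nat and ps :: "nat \<Rightarrow> nat set \<Rightarrow> real"
  assumes "r \<ge> 1"
    and "medial_regime ps"
  shows "(\<lambda>n. measure (random_complex n (ps n)) {Y \<in> space (random_complex n (ps n)). ample r Y})
           \<longlonglongrightarrow> 1"
proof -
  obtain p where p: "0 < p" "p < 1"
    and ps: "\<And>n \<sigma>. \<sigma> \<in> full_simplex n \<Longrightarrow> ps n \<sigma> \<in> {p..1 - p}"
    using assms(2) unfolding medial_regime_def by blast
  let ?prob = "\<lambda>n. measure (random_complex n (ps n))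
    {Y \<in> space (random_complex n (ps n)). ample r Y}"
  let ?e = "\<lambda>n. (real n + 1) ^ r * 2 ^ 2 ^ r * (1 - p ^ 2 ^ r) ^ (n - r)"
  have eq: "?prob n = measure_pmf.prob (random_selection n (ps n)) {h. ample r (kernel_complex n h)}"
    for n
  proof (rule measure_random_complex)
    show "ps n \<sigma> \<in> {0..1}" if "\<sigma> \<in> full_simplex n" for \<sigma>
      using ps[OF that] p by auto
  qed
  have lower: "1 - ?e n \<le> ?prob n" for n
  proof -
    have "measure_pmf.prob (random_selection n (ps n)) {h. \<not> ample r (kernel_complex n h)}
        = 1 - ?prob n"
      unfolding eq using measure_pmf.prob_compl[of "{h. ample r (kernel_complex n h)}"]
      by (simp add: Compl_eq_Diff_UNIV[symmetric] Collect_neg_eq)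
    then show ?thesis using prob_not_ample_le[of p n "ps n" r, OF p ps] by simp
  qed
  \<comment> \<open>Since \<open>0 < p < 1\<close>, the base \<open>1 - p ^ 2 ^ r\<close> lies
    strictly between 0 and 1, and it is the same for all \<open>n\<close> because \<open>p\<close>
    and \<open>r\<close> are fixed.\<close>
  have "?e \<longlonglongrightarrow> 0"
    using p by (intro polynomial_times_geometric_tendsto_0) (auto simp: power_less_one_iff)
  then have lim: "(\<lambda>n. 1 - ?e n) \<longlonglongrightarrow> 1"
    using tendsto_diff[OF tendsto_const[of 1], of ?e 0] by simp
  show ?thesis
  proof (rule tendsto_sandwich[OF _ _ lim tendsto_const])
    show "\<forall>\<^sub>F n in sequentially. 1 - ?e n \<le> ?prob n" using lower by simp
    show "\<forall>\<^sub>F n in sequentially. ?prob n \<le> 1" unfolding eq by simp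
  qed
qed

end
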